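(* Consider a private information retrieval query scheme with $M\ge 2$ messages and $S\ge 2$ servers, whose queries are generated as $Q_{1:S}^{(m)}=\psi(m,F)$ with $\psi$ a bijection onto the query realization set $\mathcal{Q}$, the index $\theta$ being uniform on $[1:M]$ and $Q_{1:S}^{(\theta)}$ being uniform on $\mathcal{Q}$ (see context). Assume $H(Q_{1:S}^{(\theta)}\mid\theta=m)=H(Q_{1:S}^{(\theta)}\mid\theta=m')$ for all $m,m'\in[1:M]$. Let $j\in[1:S]$ and let $q_j$ be a possible value of the query to server $j$. Then $$\Pr\{Q_j^{(\theta)}=q_j\mid\theta=m\}=\Pr\{Q_j^{(\theta)}=q_j\mid\theta=m'\}\quad\text{for all } m,m'\in[1:M]$$ if and only if $$\bigl|\{Q_{1:S}^{(\theta)}\mid Q_j^{(\theta)}=q_j\}\bigr| = M\,\bigl|\{Q_{1:S}^{(m)}\mid Q_j^{(m)}=q_j\}\bigr|\quad\text{for all } m\in[1:M].$$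
   Context: Notation: $[1:Z]=\{1,\dots,Z\}$. $H$ denotes Shannon entropy. A user wants to retrieve the message with index $\theta\in[1:M]$ from $S$ servers; $\theta$ is a random variable, uniformly distributed on $[1:M]$. When $\theta=m$, the user sends the query $Q_j^{(m)}$ to server $j$ for each $j\in[1:S]$; $Q_{1:S}^{(m)}=(Q_1^{(m)},\dots,Q_S^{(m)})$. Query generation: $F$ is a random key uniformly distributed on a finite set $\mathcal{F}$, and $Q_{1:S}^{(m)}=\psi(m,F)$, where $\psi:[1:M]\times\mathcal{F}\to\mathcal{Q}$ is a bijection onto the set $\mathcal{Q}$ of all query realizations $q_{1:S}=(q_1,\dots,q_S)$. The tuple $Q_{1:S}^{(\theta)}=\psi(\theta,F)$ is uniformly distributed on $\mathcal{Q}$ (equivalently, $\theta$ and $F$ are independent and uniform). $\{Q_{1:S}^{(\theta)}\mid Q_j^{(\theta)}=q_j\}$ denotes the set of all realizations in $\mathcal{Q}$ (over all indices and keys) whose $j$-th component equals $q_j$, and $\{Q_{1:S}^{(m)}\mid Q_j^{(m)}=q_j\}$ denotes the set of all realizations of the form $\psi(m,f)$, $f\in\mathcal{F}$, whose $j$-th component equals $q_j$. *)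

theory Defs
  imports "HOL-Probability.Probability"
begin

definition uniform_on :: "'w measure \<Rightarrow> 'b set \<Rightarrow> ('w \<Rightarrow> 'b) \<Rightarrow> bool" where
  "uniform_on P A X \<longleftrightarrow>
    X \<in> measurable P (count_space A) \<and> distr P (count_space A) X = uniform_count_measure A"

text \<open>
  \<open>entropy_given P b A X E\<close> is the Shannon entropy \<open>H(X | E)\<close>, to base \<open>b\<close>, of the \<open>A\<close>-valued
  random variable \<open>X\<close> conditioned on the single event \<open>E\<close>, i.e. its entropy under the
  conditional probability measure \<open>P( \<cdot> | E)\<close>. This differs from the library's
  \<open>conditional_entropy\<close>, which averages over the values of a conditioning random variable.
\<close>
definition entropy_given ::
    "'w measure \<Rightarrow> real \<Rightarrow> 'b set \<Rightarrow> ('w \<Rightarrow> 'b) \<Rightarrow> ('w \<Rightarrow> bool) \<Rightarrow> real" where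
  "entropy_given P b A X E =
    prob_space.entropy (uniform_measure P {\<omega> \<in> space P. E \<omega>}) b (count_space A) X"

text \<open>
  Query tuples \<open>(q\<^sub>1, \<dots>, q\<^sub>S)\<close> are functions on \<open>{1..S}\<close>, made canonical outside \<open>{1..S}\<close> by
  extensionality, so that equality of tuples is componentwise equality. The type \<open>'q\<close> holds the
  query alphabets of all servers; these need not coincide. The tuple sent to the servers is the
  random variable \<open>\<psi> (\<theta>, F)\<close>, and \<open>\<K>\<close> is the key space. Independence of \<open>\<theta>\<close> and \<open>F\<close> follows
  from uniformity of \<open>\<psi> (\<theta>, F)\<close>.
\<close>
locale pir_query_scheme = prob_space P
  for P :: "'w measure" +
  fixes M S :: nat
    and \<theta> :: "'w \<Rightarrow> nat"
    and F :: "'w \<Rightarrow> 'k"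
    and \<K> :: "'k set"
    and \<psi> :: "nat \<times> 'k \<Rightarrow> nat \<Rightarrow> 'q"
    and \<Q> :: "(nat \<Rightarrow> 'q) set"
  assumes two_messages: "M \<ge> 2"
    and two_servers: "S \<ge> 2"
    and finite_keys: "finite \<K>"
    and tuples: "\<Q> \<subseteq> extensional {1..S}"
    and bij_queries: "bij_betw \<psi> ({1..M} \<times> \<K>) \<Q>"
    and uniform_index: "uniform_on P {1..M} \<theta>"
    and uniform_key: "uniform_on P \<K> F"
    and uniform_query: "uniform_on P \<Q> (\<lambda>\<omega>. \<psi> (\<theta> \<omega>, F \<omega>))"

end

theory Submission
  imports Defs
begin

text \<open>
  Since \<open>\<psi>\<close> is a bijection, the queries generated for the different indices partition \<open>\<Q>\<close>, and
  \<open>\<theta> = m\<close> holds exactly when the query lies in the \<open>m\<close>-th part. Uniformity on \<open>\<Q>\<close> and on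
  \<open>{1..M}\<close> makes the conditional probability of \<open>q\<^sub>j\<close> given \<open>\<theta> = m\<close> proportional to the number
  \<open>c\<^sub>m\<close> of queries in the \<open>m\<close>-th part with \<open>j\<close>-th component \<open>q\<^sub>j\<close>. As the \<open>c\<^sub>m\<close> sum to the size of
  the set on the left-hand side of the cardinality condition, that condition says that every
  \<open>c\<^sub>m\<close> equals their mean.
\<close>

lemma (in prob_space) prob_uniform_on:
  assumes "uniform_on M A X" "finite A" "B \<subseteq> A"
  shows "\<P>(\<omega> in M. X \<omega> \<in> B) = card B / card A"
proof -
  have X: "X \<in> measurable M (count_space A)"
    and distr: "distr M (count_space A) X = uniform_count_measure A"
    using assms(1) by (auto simp: uniform_on_def)
  have "\<P>(\<omega> in M. X \<omega> \<in> B) = measure (distr M (count_space A) X) B"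
    using X assms(3) by (subst measure_distr) (auto intro!: arg_cong[where f = "measure M"])
  also have "\<dots> = card B / card A"
    unfolding distr using assms(2,3) by (rule measure_uniform_count_measure)
  finally show ?thesis .
qed

context pir_query_scheme
begin

text \<open>The block of \<open>\<Q>\<close> belonging to index \<open>m\<close>, written as the
  same image as in the cardinality condition so that it can be folded there.\<close>

definition queries_of :: "nat \<Rightarrow> (nat \<Rightarrow> 'q) set" where
  "queries_of m = (\<lambda>f. \<psi> (m, f)) ` \<K>"

lemma finite_queries: "finite \<Q>"
  using bij_betw_finite[OF bij_queries] finite_keys by simp

lemma finite_queries_of: "finite (queries_of m)"
  using finite_keys by (simp add: queries_of_def)

lemma queries_eq_Union: "\<Q> = (\<Union>m\<in>{1..M}. queries_of m)"
  unfolding queries_of_def bij_betw_imp_surj_on[OF bij_queries, symmetric] by auto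

text \<open>Injectivity of \<open>\<psi>\<close> on pairs: a query determines the index that
  produced it, whatever the key.\<close>

lemma query_in_queries_of_iff:
  assumes "m \<in> {1..M}" "n \<in> {1..M}" "f \<in> \<K>"
  shows "\<psi> (n, f) \<in> queries_of m \<longleftrightarrow> n = m"
  using assms inj_onD[OF bij_betw_imp_inj_on[OF bij_queries], of "(n, f)"]
  unfolding queries_of_def by blast

lemma queries_of_disjoint:
  assumes "m \<in> {1..M}" "n \<in> {1..M}" "m \<noteq> n"
  shows "queries_of m \<inter> queries_of n = {}"
proof (rule equals0I, elim IntE)
  fix q assume q: "q \<in> queries_of m" and "q \<in> queries_of n"
  then obtain f where "f \<in> \<K>" "q = \<psi> (n, f)"
    unfolding queries_of_def by (elim imageE)
  then show False
    using assms q query_in_queries_of_iff[of m n f] by simp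
qed

lemma prob_index:
  assumes "m \<in> {1..M}"
  shows "\<P>(\<omega> in P. \<theta> \<omega> = m) = 1 / M"
  using prob_uniform_on[OF uniform_index, of "{m}"] assms by simp

text \<open>Because the query determines the index, the joint event says only that the query tuple
  lies in a certain subset of \<open>\<Q>\<close>, and uniformity on \<open>\<Q>\<close> gives its
  probability.\<close>

lemma prob_query_and_index:
  assumes m: "m \<in> {1..M}"
  shows "\<P>(\<omega> in P. \<psi> (\<theta> \<omega>, F \<omega>) j = qj \<and> \<theta> \<omega> = m) =
    card {q \<in> queries_of m. q j = qj} / card \<Q>"
proof -
  let ?B = "{q \<in> queries_of m. q j = qj}"
  \<comment> \<open>Measurability into a count space bounds the values only on
    \<open>space P\<close>, so the events are compared pointwise there.\<close>
  have \<theta>: "\<theta> \<omega> \<in> {1..M}" and F: "F \<omega> \<in> \<K>" if "\<omega> \<in> space P" for \<omega>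
    using that uniform_index uniform_key measurable_space[of \<theta> P "count_space {1..M}" \<omega>]
      measurable_space[of F P "count_space \<K>" \<omega>]
    by (simp_all add: uniform_on_def)
  have "\<psi> (\<theta> \<omega>, F \<omega>) j = qj \<and> \<theta> \<omega> = m \<longleftrightarrow> \<psi> (\<theta> \<omega>, F \<omega>) \<in> ?B"
    if "\<omega> \<in> space P" for \<omega>
    unfolding mem_Collect_eq using query_in_queries_of_iff[OF m \<theta> F, OF that that] by argo
  then have eq: "{\<omega> \<in> space P. \<psi> (\<theta> \<omega>, F \<omega>) j = qj \<and> \<theta> \<omega> = m} =
      {\<omega> \<in> space P. \<psi> (\<theta> \<omega>, F \<omega>) \<in> ?B}"
    by (rule Collect_cong[OF conj_cong[OF refl]])
  have "?B \<subseteq> \<Q>"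
    using m by (auto simp: queries_eq_Union)
  then show ?thesis
    unfolding eq by (rule prob_uniform_on[OF uniform_query finite_queries])
qed

text \<open>The factor \<open>M\<close> comes from dividing by the probability \<open>1 / M\<close>
  of the index.\<close>

lemma cond_prob_query:
  assumes "m \<in> {1..M}"
  shows "\<P>(\<omega> in P. \<psi> (\<theta> \<omega>, F \<omega>) j = qj \<bar> \<theta> \<omega> = m) =
    M * card {q \<in> queries_of m. q j = qj} / card \<Q>"
  using prob_query_and_index[OF assms] prob_index[OF assms] by (simp add: cond_prob_def)

lemma card_queries_eq_sum:
  "card {q \<in> \<Q>. q j = qj} = (\<Sum>m\<in>{1..M}. card {q \<in> queries_of m. q j = qj})"
proof -
  have "{q \<in> \<Q>. q j = qj} = (\<Union>m\<in>{1..M}. {q \<in> queries_of m. q j = qj})"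
    unfolding queries_eq_Union by blast
  also have "card \<dots> = (\<Sum>m\<in>{1..M}. card {q \<in> queries_of m. q j = qj})"
  proof (intro card_UN_disjoint ballI impI)
    fix m n assume "m \<in> {1..M}" "n \<in> {1..M}" "m \<noteq> n"
    from queries_of_disjoint[OF this]
    show "{q \<in> queries_of m. q j = qj} \<inter> {q \<in> queries_of n. q j = qj} = {}"
      by blast
  qed (simp_all add: finite_queries_of)
  finally show ?thesis .
qed

end

theorem theorem1:
  fixes P :: "'w measure"
    and M S j :: nat
    and \<theta> :: "'w \<Rightarrow> nat"
    and F :: "'w \<Rightarrow> 'k"
    and \<K> :: "'k set"
    and \<psi> :: "nat \<times> 'k \<Rightarrow> nat \<Rightarrow> 'q"
    and \<Q> :: "(nat \<Rightarrow> 'q) set"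
    and b :: real
    and qj :: 'q
  assumes scheme: "pir_query_scheme P M S \<theta> F \<K> \<psi> \<Q>"
    and base: "b > 1"
    and equal_entropy: "\<forall>m\<in>{1..M}. \<forall>m'\<in>{1..M}.
          entropy_given P b \<Q> (\<lambda>\<omega>. \<psi> (\<theta> \<omega>, F \<omega>)) (\<lambda>\<omega>. \<theta> \<omega> = m) =
          entropy_given P b \<Q> (\<lambda>\<omega>. \<psi> (\<theta> \<omega>, F \<omega>)) (\<lambda>\<omega>. \<theta> \<omega> = m')"
    and server: "j \<in> {1..S}"
    and possible: "qj \<in> (\<lambda>q. q j) ` \<Q>"
  shows "(\<forall>m\<in>{1..M}. \<forall>m'\<in>{1..M}.
            \<P>(\<omega> in P. \<psi> (\<theta> \<omega>, F \<omega>) j = qj \<bar> \<theta> \<omega> = m) =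
            \<P>(\<omega> in P. \<psi> (\<theta> \<omega>, F \<omega>) j = qj \<bar> \<theta> \<omega> = m'))
     \<longleftrightarrow> (\<forall>m\<in>{1..M}.
            card {q \<in> \<Q>. q j = qj} = M * card {q \<in> (\<lambda>f. \<psi> (m, f)) ` \<K>. q j = qj})"
proof -
  interpret pir_query_scheme P M S \<theta> F \<K> \<psi> \<Q>
    by (fact scheme)
  define c where "c m = card {q \<in> queries_of m. q j = qj}" for m
  define p where "p m = \<P>(\<omega> in P. \<psi> (\<theta> \<omega>, F \<omega>) j = qj \<bar> \<theta> \<omega> = m)" for m
  have p: "p m = M * c m / card \<Q>" if "m \<in> {1..M}" for m
    unfolding p_def c_def using that by (rule cond_prob_query)
  have M: "M > 0" using two_messages by simp
  \<comment> \<open>Since \<open>qj\<close> occurs in some query, \<open>\<Q>\<close> is nonempty;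
    the common factor \<open>M / card \<Q>\<close> is then nonzero and cancels.\<close>
  have "card \<Q> > 0"
    using possible finite_queries by (auto simp: card_gt_0_iff)
  then have p_eq_iff: "p m = p m' \<longleftrightarrow> c m = c m'" if "m \<in> {1..M}" "m' \<in> {1..M}" for m m'
    using M by (simp add: p[OF that(1)] p[OF that(2)])
  have "(\<forall>m\<in>{1..M}. \<forall>m'\<in>{1..M}. c m = c m') \<longleftrightarrow>
      (\<forall>m\<in>{1..M}. (\<Sum>m'\<in>{1..M}. c m') = M * c m)"
  proof (intro iffI ballI)
    fix m assume eq: "\<forall>m\<in>{1..M}. \<forall>m'\<in>{1..M}. c m = c m'" and m: "m \<in> {1..M}"
    have "(\<Sum>m'\<in>{1..M}. c m') = (\<Sum>m'\<in>{1..M}. c m)"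
      using eq m by (intro sum.cong refl) blast
    then show "(\<Sum>m'\<in>{1..M}. c m') = M * c m" by simp
  next
    fix m m' assume mean: "\<forall>m\<in>{1..M}. (\<Sum>m'\<in>{1..M}. c m') = M * c m"
      and "m \<in> {1..M}" "m' \<in> {1..M}"
    \<comment> \<open>Both sides equal the total of all block counts, which does not depend on the
      index.\<close>
    then have "M * c m = M * c m'"
      using mean[THEN bspec, of m] mean[THEN bspec, of m'] by linarith
    then show "c m = c m'" using M by simp
  qed
  then show ?thesis
    \<comment> \<open>Turns the left side of the cardinality condition into the sum of the
      \<open>c m\<close>.\<close>
    unfolding card_queries_eq_sum queries_of_def[symmetric] c_def[symmetric] p_def[symmetric]
    by (simp only: p_eq_iff cong: ball_cong)
qed

end
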